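(* Let $F$ be a field, and let $M$ be an atomic reduced torsion-free monoid having a submonoid $N$ that satisfies the following conditions: (1) $N$ is a valuation monoid and a greatest-divisor submonoid of $M$, and (2) $\mathsf{L}_M(m - \mathrm{gd}_N(m))$ is finite for every $m \in M$. Let $S = \{f \in F[M] \mid f(0) \neq 0\}$. If $M$ does not satisfy the ACCP, then $F[M]_S$ is an atomic integral domain that does not satisfy the ACCP.
   Context: A monoid is a cancellative commutative semigroup with identity, written additively. For a monoid $M$, $\mathcal{U}(M)$ is its group of invertible elements; $M$ is reduced if $\mathcal{U}(M)$ is trivial; $M$ is torsion-free if for all $a,b \in M$, $na = nb$ for some positive integer $n$ implies $a=b$ (equivalently, its difference group is torsion-free). For $b_1,b_2 \in M$, write $b_2 \mid_M b_1$ if $b_1 \in b_2 + M$. $M$ is a valuation monoid if for all $b_1,b_2 \in M$, $b_1 \mid_M b_2$ or $b_2 \mid_M b_1$. A principal ideal of $M$ is a set $b + M$ with $b \in M$; $M$ satisfies the ascending chain condition on principal ideals (ACCP) if every increasing (under inclusion) sequence of principal ideals of $M$ eventually stabilizes. An integral domain satisfies the ACCP if every ascending chain of its principal ideals eventually stabilizes. An element $a \in M \setminus \mathcal{U}(M)$ is an atom if $a = u+v$ with $u,v \in M$ implies $u \in \mathcal{U}(M)$ or $v \in \mathcal{U}(M)$. $M$ is atomic if every non-invertible element is a finite sum of atoms. An integral domain is atomic if every nonzero nonunit factors as a finite product of irreducibles. For a reduced monoid $M$ and $b \in M$, $\mathsf{L}_M(b)$ is the set of all $\ell \in \mathbb{N}_0$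 such that $b$ is a sum of exactly $\ell$ atoms of $M$ (repetitions counted; $0$ is the empty sum). Let $N$ be a submonoid of $M$. For $m \in M$, a greatest divisor of $m$ in $N$ is an element $d \in N$ such that $d \mid_M m$, and such that $d' \mid_M d$ for every $d' \in N$ with $d' \mid_M m$. $N$ is a greatest-divisor submonoid of $M$ if every element of $M$ has a greatest divisor in $N$. When $M$ is reduced the greatest divisor of $m$ in $N$ is unique and is denoted $\mathrm{gd}_N(m)$; $m - \mathrm{gd}_N(m)$ denotes the unique $y \in M$ with $m = \mathrm{gd}_N(m) + y$. $F[M]$ is the monoid ring of $M$ over $F$ (polynomial expressions in $X$ with exponents in $M$ and coefficients in $F$), which is an integral domain since $M$ is torsion-free. For $f \in F[M]$, $f(0)$ denotes the coefficient of $X^0$ in $f$. The set $S$ is multiplicative, and $F[M]_S$ is the localization of $F[M]$ at $S$. *)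

theory Defs
  imports "HOL-Library.Poly_Mapping" "HOL-Algebra.Ring_Divisibility"
begin

section \<open>Commutative monoids, written additively\<close>

text \<open>
  The ambient monoid is a type of class \<^class>\<open>comm_monoid_add\<close>; cancellativity is an explicit
  hypothesis wherever it is needed. (The class \<^class>\<open>cancel_comm_monoid_add\<close> would in addition
  impose a total subtraction with its own laws, which is not part of the notion of a cancellative
  monoid.) Submonoids are sets.
\<close>

definition submonoid_add :: "'m::comm_monoid_add set \<Rightarrow> bool" where
  "submonoid_add N \<longleftrightarrow> 0 \<in> N \<and> (\<forall>a\<in>N. \<forall>b\<in>N. a + b \<in> N)"

definition add_units :: "'m::comm_monoid_add set" where
  "add_units = {u. \<exists>v. u + v = 0}"

text \<open>The principal ideal \<open>b + H\<close> of the (sub)monoid \<open>H\<close>, and divisibility inside \<open>H\<close>.\<close>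

definition principal_add_ideal :: "'m::comm_monoid_add set \<Rightarrow> 'm \<Rightarrow> 'm set" where
  "principal_add_ideal H b = {b + c | c. c \<in> H}"

definition add_dvd_in :: "'m::comm_monoid_add set \<Rightarrow> 'm \<Rightarrow> 'm \<Rightarrow> bool" where
  "add_dvd_in H b a \<longleftrightarrow> a \<in> principal_add_ideal H b"

abbreviation add_dvd :: "'m::comm_monoid_add \<Rightarrow> 'm \<Rightarrow> bool" where
  "add_dvd \<equiv> add_dvd_in UNIV"

definition valuation_submonoid :: "'m::comm_monoid_add set \<Rightarrow> bool" where
  "valuation_submonoid N \<longleftrightarrow> submonoid_add N \<and> (\<forall>a\<in>N. \<forall>b\<in>N. add_dvd_in N a b \<or> add_dvd_in N b a)"

definition monoid_ACCP :: "'m::comm_monoid_add itself \<Rightarrow> bool" where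
  "monoid_ACCP _ \<longleftrightarrow>
     (\<forall>I :: nat \<Rightarrow> 'm set. (\<forall>n. \<exists>b. I n = principal_add_ideal UNIV b) \<and> incseq I
        \<longrightarrow> (\<exists>k. \<forall>n\<ge>k. I n = I k))"

definition add_atoms :: "'m::comm_monoid_add set" where
  "add_atoms = {a. a \<notin> add_units \<and> (\<forall>u v. a = u + v \<longrightarrow> u \<in> add_units \<or> v \<in> add_units)}"

definition atomic_monoid :: "'m::comm_monoid_add itself \<Rightarrow> bool" where
  "atomic_monoid _ \<longleftrightarrow>
     (\<forall>b::'m. b \<notin> add_units \<longrightarrow> (\<exists>A. set_mset A \<subseteq> add_atoms \<and> \<Sum>\<^sub># A = b))"

definition length_set :: "'m::comm_monoid_add \<Rightarrow> nat set" where
  "length_set b = {size A | A. set_mset A \<subseteq> add_atoms \<and> \<Sum>\<^sub># A = b}"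

definition is_greatest_divisor :: "'m::comm_monoid_add set \<Rightarrow> 'm \<Rightarrow> 'm \<Rightarrow> bool" where
  "is_greatest_divisor N m d \<longleftrightarrow>
     d \<in> N \<and> add_dvd d m \<and> (\<forall>d'\<in>N. add_dvd d' m \<longrightarrow> add_dvd d' d)"

definition greatest_divisor_submonoid :: "'m::comm_monoid_add set \<Rightarrow> bool" where
  "greatest_divisor_submonoid N \<longleftrightarrow> submonoid_add N \<and> (\<forall>m. \<exists>d. is_greatest_divisor N m d)"

text \<open>
  The following two are meaningful for a greatest-divisor submonoid \<open>N\<close> of a reduced cancellative
  monoid, where the described elements exist and are unique; the second one is \<open>m - gd\<^sub>N(m)\<close>.
\<close>

definition gd :: "'m::comm_monoid_add set \<Rightarrow> 'm \<Rightarrow> 'm" where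
  "gd N m = (THE d. is_greatest_divisor N m d)"

definition gd_cofactor :: "'m::comm_monoid_add set \<Rightarrow> 'm \<Rightarrow> 'm" where
  "gd_cofactor N m = (THE y. m = gd N m + y)"


section \<open>Localization of a commutative ring\<close>

text \<open>
  The localization of \<^typ>\<open>'a::comm_ring_1\<close> at a multiplicative set \<open>S\<close> (with \<open>1 \<in> S\<close>): the class of \<open>(a, s)\<close> under
  \<open>frac_rel S\<close> is the fraction \<open>a/s\<close>. The ring is given as an explicit structure because it depends
  on the set \<open>S\<close>.
\<close>

definition frac_rel :: "'a::comm_ring_1 set \<Rightarrow> (('a \<times> 'a) \<times> ('a \<times> 'a)) set" where
  "frac_rel S = {((a, s), (b, t)). s \<in> S \<and> t \<in> S \<and> (\<exists>u\<in>S. u * (a * t - b * s) = 0)}"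

definition loc_frac :: "'a::comm_ring_1 set \<Rightarrow> 'a \<Rightarrow> 'a \<Rightarrow> ('a \<times> 'a) set" where
  "loc_frac S a s = frac_rel S `` {(a, s)}"

definition localization :: "'a::comm_ring_1 set \<Rightarrow> ('a \<times> 'a) set ring" where
  "localization S =
     \<lparr>carrier = (UNIV \<times> S) // frac_rel S,
      monoid.mult = (\<lambda>P Q. \<Union>(a, s)\<in>P. \<Union>(b, t)\<in>Q. loc_frac S (a * b) (s * t)),
      one = loc_frac S 1 1,
      zero = loc_frac S 0 1,
      add = (\<lambda>P Q. \<Union>(a, s)\<in>P. \<Union>(b, t)\<in>Q. loc_frac S (a * t + b * s) (s * t))\<rparr>"


section \<open>Atomicity and the ACCP for integral domains\<close>

definition atomic_domain :: "('a, 'b) ring_scheme \<Rightarrow> bool" where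
  "atomic_domain R \<longleftrightarrow> domain R \<and>
     (\<forall>a \<in> carrier R - {\<zero>\<^bsub>R\<^esub>} - Units R.
        \<exists>fs. set fs \<subseteq> carrier R \<and> (\<forall>p\<in>set fs. ring_irreducible\<^bsub>R\<^esub> p) \<and>
             foldr (\<otimes>\<^bsub>R\<^esub>) fs \<one>\<^bsub>R\<^esub> = a)"

definition ring_ACCP :: "('a, 'b) ring_scheme \<Rightarrow> bool" where
  "ring_ACCP R \<longleftrightarrow>
     (\<forall>I :: nat \<Rightarrow> 'a set. (\<forall>n. principalideal (I n) R) \<and> incseq I
        \<longrightarrow> (\<exists>k. \<forall>n\<ge>k. I n = I k))"

end

theory Submission
  imports Defs
begin

text \<open>
  Write \<open>X\<^sup>m\<close> for the monomial of exponent \<open>m\<close>. Everything is read off from single coefficients.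
  Since \<open>M\<close> is reduced, the constant coefficient is multiplicative; hence \<open>S\<close> is a saturated
  multiplicative set, and a fraction \<open>f/s\<close> is a unit exactly when \<open>f \<in> S\<close>. Moreover, multiplying
  \<open>f\<close> by an element of \<open>S\<close> scales by a nonzero constant the coefficient of every exponent that is
  minimal, with respect to divisibility, in the support of \<open>f\<close> (\<open>lookup_mult_minimal\<close>).

  \<^emph>\<open>Domain.\<close> A torsion-free cancellative monoid carries a total order compatible with addition
  (\<open>torsion_free_total_translation_order\<close>), and the product of two leading terms survives in a
  product. So \<open>F[M]\<close> has no zero divisors, and neither has its localization.

  \<^emph>\<open>No ACCP.\<close> Comparing one coefficient shows that \<open>X\<^sup>a\<close> divides \<open>X\<^sup>b\<close> in the localization only
  if \<open>a\<close> divides \<open>b\<close> in \<open>M\<close> (\<open>loc_monom_divides_iff\<close>). A strictly ascending sequence of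
  principal ideals of \<open>M\<close> therefore gives one in the localization.

  \<^emph>\<open>Atomicity.\<close> Let \<open>f \<noteq> 0\<close>. Because \<open>N\<close> is a valuation monoid, one of the finitely many greatest
  divisors \<open>gd\<^sub>N(m)\<close>, for \<open>m\<close> in the support of \<open>f\<close>, divides all the others; call it
  \<open>d = gd\<^sub>N(k)\<close>. Then \<open>f = X\<^sup>d g\<close>, and the support of \<open>g\<close> contains \<open>k - gd\<^sub>N(k)\<close>, which has
  finitely many lengths (\<open>monomial_times_finite_length\<close>). The two factors are treated separately.
  Writing \<open>d\<close> as a sum of atoms factors \<open>X\<^sup>d\<close> into monomials \<open>X\<^sup>a\<close> with \<open>a\<close> an atom, and these
  are irreducible (\<open>ring_irreducible_loc_monom\<close>). For \<open>g\<close>, take a minimal exponent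
  \<open>m\<^sub>0\<close> of its support below \<open>k - gd\<^sub>N(k)\<close>; it also has finitely many lengths. If \<open>g\<close> is a product
  of \<open>n\<close> nonunits, then \<open>m\<^sub>0\<close> occurs as an exponent of a product of \<open>n\<close> elements without constant
  term, so it is a sum of \<open>n\<close> nonzero elements and possibly one more, and it has a length \<open>\<ge> n\<close>.
  Hence \<open>n\<close> is bounded (\<open>factorization_length_bounded\<close>), and a factorization of \<open>g\<close> into as many
  nonunits as possible consists of irreducible elements.
\<close>

section \<open>Total orders on torsion-free monoids\<close>

text \<open>
  Without subtraction, the last condition is what makes \<open>R\<close> the trace of a partial order on the
  difference group; its positive cone is the set of all \<open>b - a\<close> with \<open>(a, b) \<in> R\<close>. Transitivity
  follows from the other conditions.
\<close>
definition translation_order :: "('m::comm_monoid_add \<times> 'm) set \<Rightarrow> bool" where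
  "translation_order R \<longleftrightarrow> refl R \<and> antisym R \<and>
     (\<forall>a b c d. (a, b) \<in> R \<longrightarrow> (c, d) \<in> R \<longrightarrow> (a + c, b + d) \<in> R) \<and>
     (\<forall>a b c. (a + c, b + c) \<in> R \<longrightarrow> (a, b) \<in> R)"

lemma translation_orderD:
  assumes "translation_order R"
  shows translation_order_refl: "(a, a) \<in> R"
    and translation_order_antisym: "(a, b) \<in> R \<Longrightarrow> (b, a) \<in> R \<Longrightarrow> a = b"
    and translation_order_add: "(a, b) \<in> R \<Longrightarrow> (c, d) \<in> R \<Longrightarrow> (a + c, b + d) \<in> R"
    and translation_order_cancel: "(a + c, b + c) \<in> R \<Longrightarrow> (a, b) \<in> R"
  using assms unfolding translation_order_def refl_on_def antisym_def by blast+

lemma translation_order_trans: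
  assumes "translation_order R" "(a, b) \<in> R" "(b, c) \<in> R"
  shows "(a, c) \<in> R"
  using translation_order_add[OF assms] translation_order_cancel[OF assms(1), of a b c]
  by (simp add: add.commute)

lemma translation_order_sum:
  assumes "translation_order R" "(a, b) \<in> R"
  shows "((\<Sum>i<n::nat. a), (\<Sum>i<n. b)) \<in> R"
  by (induction n) (auto intro: translation_order_refl translation_order_add assms)

lemma sum_const_add: "(\<Sum>i<n + k. a) = (\<Sum>i<n::nat. a) + (\<Sum>i<k. a :: 'm::comm_monoid_add)"
  by (induction k) (simp_all add: ac_simps)

text \<open>
  The relation that \<open>R\<close> generates together with \<open>x \<le> y\<close>: in the difference group, the positive
  cone grows by the multiples \<open>n (y - x)\<close>, and \<open>b - a - n (y - x)\<close> is again in the old cone.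
\<close>
definition adjoin_le :: "('m::comm_monoid_add \<times> 'm) set \<Rightarrow> 'm \<Rightarrow> 'm \<Rightarrow> ('m \<times> 'm) set" where
  "adjoin_le R x y = {(a, b). \<exists>n::nat. (a + (\<Sum>i<n. y), b + (\<Sum>i<n. x)) \<in> R}"

text \<open>
  Antisymmetry is the only condition at risk. Adding the two inequalities that witness \<open>a \<le> b\<close> and
  \<open>b \<le> a\<close> and cancelling \<open>a + b\<close> leaves \<open>k y \<le> k x\<close> in \<open>R\<close>, where \<open>k\<close> is the total number of
  uses of \<open>x \<le> y\<close>.
\<close>
lemma translation_order_adjoin_le:
  assumes R: "translation_order R"
    and no_multiple: "\<And>k::nat. k > 0 \<Longrightarrow> ((\<Sum>i<k. y), (\<Sum>i<k. x)) \<notin> R"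
  shows "translation_order (adjoin_le R x y)" "R \<subseteq> adjoin_le R x y" "(x, y) \<in> adjoin_le R x y"
proof -
  show sub: "R \<subseteq> adjoin_le R x y"
    unfolding adjoin_le_def by (auto intro!: exI[of _ 0])
  show "(x, y) \<in> adjoin_le R x y"
    unfolding adjoin_le_def
    by (auto intro!: exI[of _ 1] simp: add.commute[of y x] translation_order_refl[OF R])
  show "translation_order (adjoin_le R x y)"
    unfolding translation_order_def
  proof (intro conjI allI impI)
    show "refl (adjoin_le R x y)"
      using sub translation_order_refl[OF R] by (auto simp: refl_on_def)
  next
    show "antisym (adjoin_le R x y)"
    proof (rule antisymI)
      fix a b assume "(a, b) \<in> adjoin_le R x y" "(b, a) \<in> adjoin_le R x y"
      then obtain n k where n: "(a + (\<Sum>i<n::nat. y), b + (\<Sum>i<n. x)) \<in> R"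
        and k: "(b + (\<Sum>i<k::nat. y), a + (\<Sum>i<k. x)) \<in> R"
        unfolding adjoin_le_def by blast
      have "((\<Sum>i<n + k. y) + (a + b), (\<Sum>i<n + k. x) + (a + b)) \<in> R"
        using translation_order_add[OF R n k] by (simp add: sum_const_add ac_simps)
      then have "((\<Sum>i<n + k. y), (\<Sum>i<n + k. x)) \<in> R"
        by (rule translation_order_cancel[OF R])
      then have "n + k = 0" using no_multiple by blast
      then show "a = b" using n k translation_order_antisym[OF R] by simp
    qed
  next
    fix a b c d assume "(a, b) \<in> adjoin_le R x y" "(c, d) \<in> adjoin_le R x y"
    then obtain n k where n: "(a + (\<Sum>i<n::nat. y), b + (\<Sum>i<n. x)) \<in> R"
      and k: "(c + (\<Sum>i<k::nat. y), d + (\<Sum>i<k. x)) \<in> R"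
      unfolding adjoin_le_def by blast
    have "(a + c + (\<Sum>i<n + k. y), b + d + (\<Sum>i<n + k. x)) \<in> R"
      using translation_order_add[OF R n k] by (simp add: sum_const_add ac_simps)
    then show "(a + c, b + d) \<in> adjoin_le R x y"
      unfolding adjoin_le_def by blast
  next
    fix a b c assume "(a + c, b + c) \<in> adjoin_le R x y"
    then obtain n where "(a + c + (\<Sum>i<n::nat. y), b + c + (\<Sum>i<n. x)) \<in> R"
      unfolding adjoin_le_def by blast
    then have "(a + (\<Sum>i<n. y) + c, b + (\<Sum>i<n. x) + c) \<in> R" by (simp add: ac_simps)
    then show "(a, b) \<in> adjoin_le R x y"
      using translation_order_cancel[OF R] unfolding adjoin_le_def by blast
  qed
qed

lemma translation_order_Union:
  assumes "C \<noteq> {}" and chain: "subset.chain {R. translation_order R} C"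
  shows "translation_order (\<Union>C)"
proof -
  have mem: "translation_order R" if "R \<in> C" for R
    using chain that by (auto simp: subset.chain_def)
  have joint: "\<exists>R\<in>C. p \<in> R \<and> q \<in> R" if "p \<in> \<Union>C" "q \<in> \<Union>C" for p q
    using chain that unfolding subset_chain_def by blast
  show ?thesis
    unfolding translation_order_def
  proof (intro conjI allI impI)
    show "refl (\<Union>C)"
      using \<open>C \<noteq> {}\<close> mem translation_order_refl by (fastforce simp: refl_on_def)
    show "antisym (\<Union>C)"
      by (rule antisymI) (metis joint mem translation_order_antisym)
    show "(a + c, b + d) \<in> \<Union>C" if "(a, b) \<in> \<Union>C" "(c, d) \<in> \<Union>C" for a b c d
      using joint[OF that] mem translation_order_add by blast
    show "(a, b) \<in> \<Union>C" if "(a + c, b + c) \<in> \<Union>C" for a b c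
      using that mem translation_order_cancel by blast
  qed
qed

text \<open>
  Take a maximal translation order by Zorn's lemma. If neither \<open>x \<le> y\<close> nor \<open>y \<le> x\<close> can be added
  to it, then it contains \<open>k y \<le> k x\<close> and \<open>l x \<le> l y\<close> with \<open>k, l > 0\<close>, so \<open>l k x = l k y\<close> and
  \<open>x = y\<close> by torsion-freeness.
\<close>
lemma torsion_free_total_translation_order:
  assumes cancel: "\<And>a b c :: 'm::comm_monoid_add. a + b = a + c \<Longrightarrow> b = c"
    and torsion_free: "\<And>(a::'m) b (n::nat). n > 0 \<Longrightarrow> (\<Sum>i<n. a) = (\<Sum>i<n. b) \<Longrightarrow> a = b"
  shows "\<exists>R :: ('m \<times> 'm) set. translation_order R \<and> total R"
proof -
  have right_cancel: "a = b" if "a + c = b + c" for a b c :: 'm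
    using cancel[of c a b] that by (simp add: add.commute)
  have "translation_order (Id :: ('m \<times> 'm) set)"
    unfolding translation_order_def
    by (auto simp: refl_Id antisym_Id dest: right_cancel)
  then have "\<exists>R\<in>{R :: ('m \<times> 'm) set. translation_order R}.
      \<forall>X\<in>{R. translation_order R}. R \<subseteq> X \<longrightarrow> X = R"
    by (intro subset_Zorn_nonempty) (auto intro: translation_order_Union)
  then obtain R :: "('m \<times> 'm) set" where R: "translation_order R"
    and maximal: "\<And>X. translation_order X \<Longrightarrow> R \<subseteq> X \<Longrightarrow> X = R"
    by blast
  have multiple: "\<exists>k::nat. k > 0 \<and> ((\<Sum>i<k. y), (\<Sum>i<k. x)) \<in> R" if "(x, y) \<notin> R" for x y
    using translation_order_adjoin_le[OF R, of y x] maximal that by blast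
  have "total R"
  proof (intro total_onI, rule ccontr)
    fix x y :: 'm assume "x \<noteq> y" and no: "\<not> ((x, y) \<in> R \<or> (y, x) \<in> R)"
    obtain k l :: nat where k: "k > 0" "((\<Sum>i<k. y), (\<Sum>i<k. x)) \<in> R"
      and l: "l > 0" "((\<Sum>i<l. x), (\<Sum>i<l. y)) \<in> R"
      using multiple[of x y] multiple[of y x] no by blast
    have "((\<Sum>j<l. \<Sum>i<k. y), (\<Sum>j<l. \<Sum>i<k. x)) \<in> R"
      by (rule translation_order_sum[OF R k(2)])
    moreover have "((\<Sum>j<l. \<Sum>i<k. x), (\<Sum>j<l. \<Sum>i<k. y)) \<in> R"
      using translation_order_sum[OF R l(2), of k] by (subst (1 2) sum.swap)
    ultimately have "(\<Sum>j<l. \<Sum>i<k. y) = (\<Sum>j<l. \<Sum>i<k. x)"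
      by (rule translation_order_antisym[OF R])
    then have "y = x" using torsion_free k(1) l(1) by blast
    with \<open>x \<noteq> y\<close> show False by simp
  qed
  with R show ?thesis by blast
qed

lemma total_translation_order_Max:
  assumes R: "translation_order R" "total R" and "finite A" "A \<noteq> {}"
  shows "\<exists>m\<in>A. \<forall>a\<in>A. (a, m) \<in> R"
  using assms(3,4)
proof (induction rule: finite_ne_induct)
  case (singleton x)
  then show ?case using translation_order_refl[OF R(1)] by simp
next
  case (insert x F)
  then obtain m where m: "m \<in> F" "\<forall>a\<in>F. (a, m) \<in> R" by blast
  have "(x, m) \<in> R \<or> (m, x) \<in> R"
    using R(2) translation_order_refl[OF R(1)] by (cases "x = m") (auto simp: total_on_def)
  then show ?case
    using m translation_order_refl[OF R(1)] translation_order_trans[OF R(1)] by blast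
qed


section \<open>Coefficients of products in a monoid algebra\<close>

lemma lookup_mult_unique:
  fixes f g :: "'m::comm_monoid_add \<Rightarrow>\<^sub>0 'a::semiring_0"
  assumes "k = a + b"
    and unique: "\<And>u v. Poly_Mapping.lookup f u \<noteq> 0 \<Longrightarrow> Poly_Mapping.lookup g v \<noteq> 0 \<Longrightarrow> k = u + v \<Longrightarrow> u = a \<and> v = b"
  shows "Poly_Mapping.lookup (f * g) k = Poly_Mapping.lookup f a * Poly_Mapping.lookup g b"
proof -
  have "Poly_Mapping.lookup (f * g) k = (\<Sum>(u, v). Poly_Mapping.lookup f u * Poly_Mapping.lookup g v when k = u + v)"
    by (simp add: times_poly_mapping.rep_eq prod_fun_unfold_prod)
  also have "(\<lambda>(u, v). Poly_Mapping.lookup f u * Poly_Mapping.lookup g v when k = u + v) =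
      (\<lambda>p. Poly_Mapping.lookup f a * Poly_Mapping.lookup g b when p = (a, b))"
  proof (rule ext, clarify)
    fix u v
    have "Poly_Mapping.lookup f u * Poly_Mapping.lookup g v = 0" if "(u, v) \<noteq> (a, b)" "k = u + v"
      using unique[of u v] that by (cases "Poly_Mapping.lookup f u = 0"; cases "Poly_Mapping.lookup g v = 0") auto
    then show "(Poly_Mapping.lookup f u * Poly_Mapping.lookup g v when k = u + v) =
        (Poly_Mapping.lookup f a * Poly_Mapping.lookup g b when (u, v) = (a, b))"
      using assms(1) by (auto simp: when_def)
  qed
  finally show ?thesis by simp
qed

lemma keys_multE:
  assumes "Poly_Mapping.lookup (f * g) k \<noteq> 0"
  obtains u v where "Poly_Mapping.lookup f u \<noteq> 0" "Poly_Mapping.lookup g v \<noteq> 0" "k = u + v"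
  using keys_mult[of f g] assms by (auto simp: in_keys_iff)

text \<open>
  The sum of the largest exponents of \<open>f\<close> and \<open>g\<close> has no other decomposition into exponents of
  \<open>f\<close> and \<open>g\<close>, so the two leading coefficients multiply to a coefficient of \<open>f * g\<close>.
\<close>
lemma monoid_algebra_no_zero_divisors:
  fixes f g :: "'m::comm_monoid_add \<Rightarrow>\<^sub>0 'a::semiring_no_zero_divisors"
  assumes cancel: "\<And>a b c :: 'm. a + b = a + c \<Longrightarrow> b = c"
    and torsion_free: "\<And>(a::'m) b (n::nat). n > 0 \<Longrightarrow> (\<Sum>i<n. a) = (\<Sum>i<n. b) \<Longrightarrow> a = b"
    and "f * g = 0"
  shows "f = 0 \<or> g = 0"
proof (rule ccontr)
  assume "\<not> (f = 0 \<or> g = 0)"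
  then have ne: "Poly_Mapping.keys f \<noteq> {}" "Poly_Mapping.keys g \<noteq> {}" by auto
  have "\<exists>R :: ('m \<times> 'm) set. translation_order R \<and> total R"
    by (rule torsion_free_total_translation_order) (fact cancel, fact torsion_free)
  then obtain R :: "('m \<times> 'm) set" where R: "translation_order R" "total R" by blast
  obtain a b where a: "a \<in> Poly_Mapping.keys f" "\<And>u. u \<in> Poly_Mapping.keys f \<Longrightarrow> (u, a) \<in> R"
    and b: "b \<in> Poly_Mapping.keys g" "\<And>v. v \<in> Poly_Mapping.keys g \<Longrightarrow> (v, b) \<in> R"
    using total_translation_order_Max[OF R finite_keys ne(1)]
      total_translation_order_Max[OF R finite_keys ne(2)] by blast
  have "Poly_Mapping.lookup (f * g) (a + b) = Poly_Mapping.lookup f a * Poly_Mapping.lookup g b"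
  proof (rule lookup_mult_unique)
    fix u v assume u: "Poly_Mapping.lookup f u \<noteq> 0" and v: "Poly_Mapping.lookup g v \<noteq> 0" and eq: "a + b = u + v"
    have "(v + u, b + u) \<in> R"
      using translation_order_add[OF R(1) b(2) translation_order_refl[OF R(1)]] v
      by (simp add: in_keys_iff)
    then have "(a + b, u + b) \<in> R" by (simp add: eq ac_simps)
    then have "(a, u) \<in> R" by (rule translation_order_cancel[OF R(1)])
    then have "u = a"
      using a(2)[of u] u translation_order_antisym[OF R(1)] by (simp add: in_keys_iff)
    with eq cancel show "u = a \<and> v = b" by metis
  qed simp
  with a(1) b(1) \<open>f * g = 0\<close> show False by (simp add: in_keys_iff)
qed

lemma lookup_single_mult:
  fixes g :: "'m::comm_monoid_add \<Rightarrow>\<^sub>0 'a::semiring_1"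
  assumes cancel: "\<And>a b c :: 'm. a + b = a + c \<Longrightarrow> b = c"
  shows "Poly_Mapping.lookup (Poly_Mapping.single d 1 * g) (d + y) = Poly_Mapping.lookup g y"
proof -
  have "Poly_Mapping.lookup (Poly_Mapping.single d 1 * g) (d + y) = Poly_Mapping.lookup (Poly_Mapping.single d 1) d * Poly_Mapping.lookup g y"
    using cancel by (intro lookup_mult_unique) (auto simp: lookup_single when_def split: if_splits)
  then show ?thesis by simp
qed

section \<open>Localization at a saturated multiplicative set\<close>

text \<open>
  Over a ring without zero divisors the relation \<open>frac_rel S\<close> is plain cross multiplication, and
  saturation of \<open>S\<close> makes membership of the numerator in \<open>S\<close> characterize the units. The absence of
  zero divisors is a locale assumption rather than a type class, because for monoid algebras it
  depends on properties of the monoid that are not expressed by a class.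
\<close>
locale saturated_localization =
  fixes S :: "'a::comm_ring_1 set"
  assumes one_in: "1 \<in> S" and zero_not_in: "0 \<notin> S"
    and mult_in_iff: "a * b \<in> S \<longleftrightarrow> a \<in> S \<and> b \<in> S"
    and no_zero_divisors: "a * b = 0 \<Longrightarrow> a = 0 \<or> b = (0::'a)"
begin

abbreviation (input) L where "L \<equiv> localization S"

lemma cancel_denominator:
  assumes "u \<in> S" "u * a = u * b"
  shows "a = b"
proof -
  have "u * (a - b) = 0" using assms(2) by (simp add: algebra_simps)
  then show ?thesis using no_zero_divisors assms(1) zero_not_in by fastforce
qed

lemma frac_rel_iff: "((a, s), (b, t)) \<in> frac_rel S \<longleftrightarrow> s \<in> S \<and> t \<in> S \<and> a * t = b * s"
proof -
  have "u * (a * t - b * s) = 0 \<longleftrightarrow> a * t = b * s" if "u \<in> S" for u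
    using that zero_not_in no_zero_divisors[of u "a * t - b * s"] by auto
  then show ?thesis unfolding frac_rel_def using one_in by auto
qed

lemma equiv_frac_rel: "equiv (UNIV \<times> S) (frac_rel S)"
proof (rule equivI)
  show "frac_rel S \<subseteq> (UNIV \<times> S) \<times> (UNIV \<times> S)"
    by (auto simp: frac_rel_iff)
  show "refl_on (UNIV \<times> S) (frac_rel S)"
    by (auto simp: refl_on_def frac_rel_iff)
  show "sym (frac_rel S)"
    by (auto simp: sym_def frac_rel_iff)
  show "trans (frac_rel S)"
  proof (rule transI, clarify)
    fix a s b t c u
    assume "((a, s), (b, t)) \<in> frac_rel S" "((b, t), (c, u)) \<in> frac_rel S"
    then have *: "s \<in> S" "t \<in> S" "u \<in> S" "a * t = b * s" "b * u = c * t"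
      by (auto simp: frac_rel_iff)
    have "t * (a * u) = t * (c * s)"
      using *(4,5) by (metis mult.assoc mult.commute)
    with * show "((a, s), (c, u)) \<in> frac_rel S"
      by (auto simp: frac_rel_iff intro: cancel_denominator)
  qed
qed

lemma loc_frac_eq_iff:
  "s \<in> S \<Longrightarrow> t \<in> S \<Longrightarrow> loc_frac S a s = loc_frac S b t \<longleftrightarrow> a * t = b * s"
  unfolding loc_frac_def using eq_equiv_class_iff[OF equiv_frac_rel, of "(a, s)" "(b, t)"]
  by (simp add: frac_rel_iff)

lemma in_loc_frac_iff: "s \<in> S \<Longrightarrow> (b, t) \<in> loc_frac S a s \<longleftrightarrow> t \<in> S \<and> a * t = b * s"
  by (simp add: loc_frac_def frac_rel_iff)

lemma loc_frac_closed [simp]: "s \<in> S \<Longrightarrow> loc_frac S a s \<in> carrier L"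
  by (auto simp: localization_def loc_frac_def intro: quotientI)

lemma carrierE:
  assumes "x \<in> carrier L"
  obtains a s where "s \<in> S" "x = loc_frac S a s"
  using assms by (auto simp: localization_def loc_frac_def elim!: quotientE)

lemma one_loc: "\<one>\<^bsub>L\<^esub> = loc_frac S 1 1" and zero_loc: "\<zero>\<^bsub>L\<^esub> = loc_frac S 0 1"
  by (simp_all add: localization_def)

text \<open>
  The operations of the localization are unions over all representatives; such a union collapses to
  a single class as soon as its members do not depend on the representatives.
\<close>
lemma UN_loc_frac:
  assumes "s \<in> S" "t \<in> S"
    and "\<And>a' s' b' t'. s' \<in> S \<Longrightarrow> t' \<in> S \<Longrightarrow> a * s' = a' * s \<Longrightarrow> b * t' = b' * t \<Longrightarrow>
      h a' s' b' t' = C"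
  shows "(\<Union>(a', s') \<in> loc_frac S a s. \<Union>(b', t') \<in> loc_frac S b t. h a' s' b' t') = C"
proof -
  have "(a, s) \<in> loc_frac S a s" "(b, t) \<in> loc_frac S b t"
    using assms(1,2) by (auto simp: in_loc_frac_iff)
  moreover have "h a' s' b' t' = C"
    if "(a', s') \<in> loc_frac S a s" "(b', t') \<in> loc_frac S b t" for a' s' b' t'
    using that assms by (auto simp: in_loc_frac_iff)
  ultimately show ?thesis by fast
qed

lemma mult_loc:
  assumes "s \<in> S" "t \<in> S"
  shows "loc_frac S a s \<otimes>\<^bsub>L\<^esub> loc_frac S b t = loc_frac S (a * b) (s * t)"
  unfolding localization_def monoid.select_convs
proof (rule UN_loc_frac[OF assms])
  fix a' s' b' t'
  assume "s' \<in> S" "t' \<in> S" and eq: "a * s' = a' * s" "b * t' = b' * t"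
  moreover have "a' * b' * (s * t) = a * b * (s' * t')"
    using eq by (metis mult.assoc mult.left_commute)
  ultimately show "loc_frac S (a' * b') (s' * t') = loc_frac S (a * b) (s * t)"
    using assms by (simp add: loc_frac_eq_iff mult_in_iff)
qed

lemma add_loc:
  assumes "s \<in> S" "t \<in> S"
  shows "loc_frac S a s \<oplus>\<^bsub>L\<^esub> loc_frac S b t = loc_frac S (a * t + b * s) (s * t)"
  unfolding localization_def ring.select_convs
proof (rule UN_loc_frac[OF assms])
  fix a' s' b' t'
  assume "s' \<in> S" "t' \<in> S" and eq: "a * s' = a' * s" "b * t' = b' * t"
  moreover have "(a' * t' + b' * s') * (s * t) = (a' * s) * (t * t') + (b' * t) * (s * s')"
    by (simp add: algebra_simps)
  then have "(a' * t' + b' * s') * (s * t) = (a * t + b * s) * (s' * t')"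
    unfolding eq[symmetric] by (simp add: algebra_simps)
  ultimately show "loc_frac S (a' * t' + b' * s') (s' * t') = loc_frac S (a * t + b * s) (s * t)"
    using assms by (simp add: loc_frac_eq_iff mult_in_iff)
qed

lemma cring_localization: "cring L"
proof (rule cringI)
  show "abelian_group L"
  proof (rule abelian_groupI)
    show "\<exists>y\<in>carrier L. y \<oplus>\<^bsub>L\<^esub> x = \<zero>\<^bsub>L\<^esub>" if x: "x \<in> carrier L" for x
    proof -
      obtain a s where "s \<in> S" "x = loc_frac S a s" using x by (rule carrierE)
      then have "loc_frac S (- a) s \<oplus>\<^bsub>L\<^esub> x = \<zero>\<^bsub>L\<^esub>"
        by (simp add: add_loc zero_loc loc_frac_eq_iff mult_in_iff one_in)
      with \<open>s \<in> S\<close> show ?thesis by (blast intro: loc_frac_closed)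
    qed
  qed (elim carrierE | simp
      add: add_loc zero_loc loc_frac_eq_iff mult_in_iff one_in algebra_simps)+
  show "comm_monoid L"
    by (rule comm_monoidI) (elim carrierE | simp
      add: mult_loc one_loc loc_frac_eq_iff mult_in_iff one_in algebra_simps)+
  show "(x \<oplus>\<^bsub>L\<^esub> y) \<otimes>\<^bsub>L\<^esub> z = x \<otimes>\<^bsub>L\<^esub> z \<oplus>\<^bsub>L\<^esub> y \<otimes>\<^bsub>L\<^esub> z"
    if "x \<in> carrier L" "y \<in> carrier L" "z \<in> carrier L" for x y z
    using that
    by (elim carrierE) (simp add: mult_loc add_loc loc_frac_eq_iff mult_in_iff algebra_simps)
qed

lemma loc_frac_eq_zero_iff: "s \<in> S \<Longrightarrow> loc_frac S a s = \<zero>\<^bsub>L\<^esub> \<longleftrightarrow> a = 0"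
  by (simp add: zero_loc loc_frac_eq_iff one_in)

lemma domain_localization: "domain L"
proof -
  interpret cring L by (rule cring_localization)
  show ?thesis
  proof
    show "\<one>\<^bsub>L\<^esub> \<noteq> \<zero>\<^bsub>L\<^esub>"
      using one_in zero_not_in by (auto simp: one_loc loc_frac_eq_zero_iff)
    show "x = \<zero>\<^bsub>L\<^esub> \<or> y = \<zero>\<^bsub>L\<^esub>"
      if "x \<otimes>\<^bsub>L\<^esub> y = \<zero>\<^bsub>L\<^esub>" "x \<in> carrier L" "y \<in> carrier L" for x y
    proof -
      obtain a s b t where "s \<in> S" "t \<in> S" "x = loc_frac S a s" "y = loc_frac S b t"
        using \<open>x \<in> carrier L\<close> \<open>y \<in> carrier L\<close> by (metis carrierE)
      with that(1) show ?thesis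
        using no_zero_divisors[of a b] by (simp add: mult_loc loc_frac_eq_zero_iff mult_in_iff)
    qed
  qed
qed

lemma loc_frac_Units_iff:
  assumes "s \<in> S"
  shows "loc_frac S a s \<in> Units L \<longleftrightarrow> a \<in> S"
proof
  assume "loc_frac S a s \<in> Units L"
  then obtain y where "y \<in> carrier L" "loc_frac S a s \<otimes>\<^bsub>L\<^esub> y = \<one>\<^bsub>L\<^esub>"
    by (auto simp: Units_def)
  then obtain b t where "t \<in> S" "loc_frac S (a * b) (s * t) = loc_frac S 1 1"
    using assms by (auto elim!: carrierE simp: mult_loc one_loc)
  then have "a * b = s * t"
    using assms by (simp add: loc_frac_eq_iff mult_in_iff one_in)
  with assms \<open>t \<in> S\<close> show "a \<in> S" by (metis mult_in_iff)
next
  assume "a \<in> S"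
  with assms have "loc_frac S a s \<otimes>\<^bsub>L\<^esub> loc_frac S s a = \<one>\<^bsub>L\<^esub>"
    "loc_frac S s a \<otimes>\<^bsub>L\<^esub> loc_frac S a s = \<one>\<^bsub>L\<^esub>"
    by (simp_all add: mult_loc one_loc loc_frac_eq_iff mult_in_iff one_in)
  with assms \<open>a \<in> S\<close> show "loc_frac S a s \<in> Units L"
    unfolding Units_def by (auto intro: loc_frac_closed)
qed

text \<open>
  Clearing denominators: it turns a statement on factorizations into nonunits in the localization
  into one on numerators, none of which lies in \<open>S\<close>.
\<close>
lemma nonunit_product_fraction:
  assumes "set fs \<subseteq> carrier L - Units L"
  obtains gs s where "length gs = length fs" "set gs \<inter> S = {}" "s \<in> S"
    "foldr (\<otimes>\<^bsub>L\<^esub>) fs \<one>\<^bsub>L\<^esub> = loc_frac S (prod_list gs) s"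
proof -
  have "\<exists>gs s. length gs = length fs \<and> set gs \<inter> S = {} \<and> s \<in> S \<and>
      foldr (\<otimes>\<^bsub>L\<^esub>) fs \<one>\<^bsub>L\<^esub> = loc_frac S (prod_list gs) s"
    using assms
  proof (induction fs)
    case Nil
    then show ?case by (auto simp: one_loc one_in intro!: exI[of _ 1])
  next
    case (Cons f fs)
    then obtain gs s where IH: "length gs = length fs" "set gs \<inter> S = {}" "s \<in> S"
      "foldr (\<otimes>\<^bsub>L\<^esub>) fs \<one>\<^bsub>L\<^esub> = loc_frac S (prod_list gs) s"
      by auto
    obtain g t where "t \<in> S" "f = loc_frac S g t"
      using Cons.prems by (auto elim: carrierE)
    then have "g \<notin> S" using Cons.prems by (simp add: loc_frac_Units_iff)
    show ?case
      using IH \<open>t \<in> S\<close> \<open>g \<notin> S\<close> \<open>f = _\<close>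
      by (intro exI[of _ "g # gs"] exI[of _ "t * s"]) (simp add: mult_loc mult_in_iff)
  qed
  then show ?thesis using that by blast
qed

end

section \<open>Products of irreducible elements\<close>

context domain
begin

lemma ring_irreducible_unit_mult:
  assumes "u \<in> Units R" "p \<in> carrier R" "ring_irreducible p"
  shows "ring_irreducible (u \<otimes> p)"
proof (rule ring_irreducibleI)
  note p = ring_irreducibleE[OF assms(2,3)]
  note u = Units_closed[OF assms(1)] Units_inv_closed[OF assms(1)] Units_l_inv[OF assms(1)]
  have p_eq: "p = inv u \<otimes> (u \<otimes> p)"
    using u assms(2) by (simp flip: m_assoc)
  show "u \<otimes> p \<in> carrier R - {\<zero>}"
    using u p(1) assms(2) p_eq by (auto simp: integral_iff)
  show "u \<otimes> p \<notin> Units R"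
    using p(4) p_eq Units_inv_Units[OF assms(1)] Units_m_closed by metis
  fix x y assume xy: "x \<in> carrier R" "y \<in> carrier R" "u \<otimes> p = x \<otimes> y"
  have "p = (inv u \<otimes> x) \<otimes> y" using p_eq xy u by (simp add: m_assoc)
  then have "inv u \<otimes> x \<in> Units R \<or> y \<in> Units R"
    using p(5) xy u by blast
  moreover have "x = u \<otimes> (inv u \<otimes> x)"
    using xy u Units_r_inv[OF assms(1)] by (simp flip: m_assoc)
  ultimately show "x \<in> Units R \<or> y \<in> Units R"
    using assms(1) Units_m_closed by metis
qed

definition irreducible_product :: "'a \<Rightarrow> bool" where
  "irreducible_product a \<longleftrightarrow> (\<exists>fs. set fs \<subseteq> carrier R \<and> (\<forall>p\<in>set fs. ring_irreducible p) \<and>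
     foldr (\<otimes>) fs \<one> = a)"

lemma irreducible_product_one: "irreducible_product \<one>"
  unfolding irreducible_product_def by (intro exI[of _ "[]"]) simp

lemma irreducible_product_Cons:
  assumes "p \<in> carrier R" "ring_irreducible p" "irreducible_product b"
  shows "irreducible_product (p \<otimes> b)"
proof -
  from assms(3) obtain fs where "set fs \<subseteq> carrier R" "\<forall>p\<in>set fs. ring_irreducible p"
    "foldr (\<otimes>) fs \<one> = b" unfolding irreducible_product_def by blast
  with assms(1,2) show ?thesis
    unfolding irreducible_product_def by (intro exI[of _ "p # fs"]) auto
qed

lemma irreducible_product_mult:
  assumes "irreducible_product a" "irreducible_product b"
  shows "irreducible_product (a \<otimes> b)"
proof -
  from assms(1) obtain fs where "set fs \<subseteq> carrier R" "\<forall>p\<in>set fs. ring_irreducible p"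
    "foldr (\<otimes>) fs \<one> = a" unfolding irreducible_product_def by blast
  moreover from assms(2) have "b \<in> carrier R" unfolding irreducible_product_def by auto
  ultimately show ?thesis
    using assms(2)
    by (induction fs arbitrary: a) (auto simp: m_assoc intro: irreducible_product_Cons)
qed

text \<open>
  The unit is absorbed into one of the irreducible factors. There is such a factor since the product
  is not a unit.
\<close>
lemma irreducible_product_unit_mult:
  assumes "u \<in> Units R" "irreducible_product a" "u \<otimes> a \<notin> Units R"
  shows "irreducible_product (u \<otimes> a)"
proof -
  from assms(2) obtain fs where fs: "set fs \<subseteq> carrier R" "\<forall>p\<in>set fs. ring_irreducible p"
    "foldr (\<otimes>) fs \<one> = a" unfolding irreducible_product_def by blast
  show ?thesis
  proof (cases fs)
    case Nil
    then show ?thesis using fs assms(1,3) by auto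
  next
    case (Cons p qs)
    have "irreducible_product ((u \<otimes> p) \<otimes> foldr (\<otimes>) qs \<one>)"
      using fs Cons assms(1) ring_irreducible_unit_mult
      by (intro irreducible_product_Cons) (auto simp: irreducible_product_def)
    then show ?thesis using fs Cons assms(1) by (auto simp: m_assoc)
  qed
qed

text \<open>
  Among the factorizations of \<open>a\<close> into nonunits, choose a longest one. Its factors are irreducible,
  for splitting one of them would give a longer factorization.
\<close>
lemma irreducible_product_if_bounded:
  assumes a: "a \<in> carrier R" "a \<noteq> \<zero>" "a \<notin> Units R"
    and bounded: "\<And>fs. set fs \<subseteq> carrier R - Units R \<Longrightarrow> foldr (\<otimes>) fs \<one> = a \<Longrightarrow> length fs \<le> k"
  shows "irreducible_product a"
proof -
  let ?P = "\<lambda>fs. set fs \<subseteq> carrier R - Units R \<and> foldr (\<otimes>) fs \<one> = a"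
  have "?P [a]" using a by simp
  moreover have "\<forall>fs. ?P fs \<longrightarrow> length fs < Suc k" using bounded by (simp add: less_Suc_eq_le)
  ultimately obtain fs where fs: "?P fs" and longest: "\<And>gs. ?P gs \<Longrightarrow> length gs \<le> length fs"
    using ex_has_greatest_nat[of ?P "[a]" length "Suc k"] by blast
  have "ring_irreducible p" if p: "p \<in> set fs" for p
  proof (rule ring_irreducibleI)
    obtain us vs where split: "fs = us @ p # vs" using p by (meson split_list)
    have us: "foldr (\<otimes>) (us @ ws) \<one> = foldr (\<otimes>) us (foldr (\<otimes>) ws \<one>)" for ws by simp
    have vs: "foldr (\<otimes>) vs \<one> \<in> carrier R"
      using fs split by (intro multlist_closed) auto
    have "set us \<subseteq> carrier R" using fs split by auto
    then have fold_zero: "foldr (\<otimes>) us \<zero> = \<zero>" by (induction us) auto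
    have "p \<noteq> \<zero>" using fs a(2) vs fold_zero unfolding split by auto
    then show "p \<in> carrier R - {\<zero>}" "p \<notin> Units R" using fs p by auto
    fix x y assume xy: "x \<in> carrier R" "y \<in> carrier R" "p = x \<otimes> y"
    show "x \<in> Units R \<or> y \<in> Units R"
    proof (rule ccontr)
      assume "\<not> (x \<in> Units R \<or> y \<in> Units R)"
      then have "?P (us @ x # y # vs)"
        using fs xy vs unfolding split by (auto simp: m_assoc)
      from longest[OF this] show False by (simp add: split)
    qed
  qed
  with fs show ?thesis unfolding irreducible_product_def by blast
qed

end

section \<open>Divisibility and lengths in reduced monoids\<close>

lemma add_dvd_iff: "add_dvd a b \<longleftrightarrow> (\<exists>c. b = a + c)"
  by (auto simp: add_dvd_in_def principal_add_ideal_def)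

text \<open>
  The monoid is the whole type; the parameter \<open>M\<close> only carries this type.
\<close>
locale reduced_cancellative_monoid =
  fixes M :: "'m::comm_monoid_add itself"
  assumes cancel: "(a::'m) + b = a + c \<Longrightarrow> b = c"
    and reduced: "add_units = {0::'m}"
begin

lemma add_eq_0_iff: "a + b = 0 \<longleftrightarrow> a = 0 \<and> b = (0::'m)"
proof
  assume ab: "a + b = 0"
  then have "a \<in> add_units" "b \<in> add_units"
    unfolding add_units_def using add.commute[of a b] by auto
  then show "a = 0 \<and> b = 0" unfolding reduced by simp
qed simp

lemma add_dvd_antisym: "add_dvd a b \<Longrightarrow> add_dvd b a \<Longrightarrow> a = (b::'m)"
proof -
  assume "add_dvd a b" "add_dvd b a"
  then obtain c d where cd: "b = a + c" "a = b + d" by (auto simp: add_dvd_iff)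
  have "a + (c + d) = b + d" by (simp only: cd(1) add.assoc)
  also have "\<dots> = a + 0" by (simp flip: cd(2))
  finally have "c + d = 0" by (rule cancel)
  with cd show "a = b" by (simp add: add_eq_0_iff)
qed

lemma add_dvd_trans: "add_dvd a b \<Longrightarrow> add_dvd b c \<Longrightarrow> add_dvd a (c::'m)"
  by (auto simp: add_dvd_iff add.assoc)

lemma principal_add_ideal_subset_iff:
  "principal_add_ideal UNIV b \<subseteq> principal_add_ideal UNIV c \<longleftrightarrow> add_dvd c (b::'m)"
proof
  have "b + 0 \<in> principal_add_ideal UNIV b" unfolding principal_add_ideal_def by blast
  then show "principal_add_ideal UNIV b \<subseteq> principal_add_ideal UNIV c \<Longrightarrow> add_dvd c b"
    by (auto simp: add_dvd_in_def)
  show "add_dvd c b \<Longrightarrow> principal_add_ideal UNIV b \<subseteq> principal_add_ideal UNIV c"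
    by (auto simp: add_dvd_iff principal_add_ideal_def add.assoc)
qed

text \<open>
  A divisor \<open>m\<^sub>0 \<in> A\<close> of \<open>m\<close> that itself has as few divisors in \<open>A\<close> as possible is minimal,
  because divisibility is antisymmetric.
\<close>
lemma minimal_divisor_in_finite_set:
  assumes "finite A" "m \<in> A"
  obtains m\<^sub>0 :: 'm where "m\<^sub>0 \<in> A" "add_dvd m\<^sub>0 m" "\<And>u. u \<in> A \<Longrightarrow> add_dvd u m\<^sub>0 \<Longrightarrow> u = m\<^sub>0"
proof -
  let ?D = "\<lambda>u. {w \<in> A. add_dvd w u}"
  have "add_dvd m m" by (auto simp: add_dvd_iff intro: exI[of _ 0])
  then obtain m\<^sub>0 where m\<^sub>0: "m\<^sub>0 \<in> A" "add_dvd m\<^sub>0 m"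
    and least: "\<And>u. u \<in> A \<Longrightarrow> add_dvd u m \<Longrightarrow> card (?D m\<^sub>0) \<le> card (?D u)"
    using ex_has_least_nat[of "\<lambda>u. u \<in> A \<and> add_dvd u m" m "\<lambda>u. card (?D u)"] assms(2) by blast
  have "u = m\<^sub>0" if u: "u \<in> A" "add_dvd u m\<^sub>0" for u
  proof -
    have "?D u \<subseteq> ?D m\<^sub>0" using add_dvd_trans u(2) by blast
    moreover have "card (?D m\<^sub>0) \<le> card (?D u)"
      using least u m\<^sub>0(2) add_dvd_trans by blast
    ultimately have "?D u = ?D m\<^sub>0" using assms(1) by (intro card_seteq) auto
    moreover have "m\<^sub>0 \<in> ?D m\<^sub>0" using m\<^sub>0(1) by (auto simp: add_dvd_iff intro: exI[of _ 0])
    ultimately have "add_dvd m\<^sub>0 u" by blast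
    with u(2) show "u = m\<^sub>0" by (rule add_dvd_antisym)
  qed
  with m\<^sub>0 show ?thesis by (rule that)
qed

lemma gd_greatest_divisor:
  assumes "greatest_divisor_submonoid N"
  shows "is_greatest_divisor N (m::'m) (gd N m)"
proof -
  obtain d where d: "is_greatest_divisor N m d"
    using assms unfolding greatest_divisor_submonoid_def by blast
  moreover have "e = d" if "is_greatest_divisor N m e" for e
    using d that unfolding is_greatest_divisor_def by (intro add_dvd_antisym) auto
  ultimately show ?thesis unfolding gd_def by (rule theI)
qed

lemma gd_cofactor_eqI: "m = gd N m + y \<Longrightarrow> gd_cofactor N m = (y::'m)"
  unfolding gd_cofactor_def by (rule the_equality) (auto intro: cancel[of "gd N m"])

lemma valuation_submonoid_min:
  assumes "valuation_submonoid N" "finite D" "D \<noteq> {}" "D \<subseteq> N"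
  shows "\<exists>d\<in>D. \<forall>e\<in>D. add_dvd d (e::'m)"
  using assms(2-4)
proof (induction rule: finite_ne_induct)
  case (singleton x)
  show ?case by (auto simp: add_dvd_iff intro: exI[of _ 0])
next
  case (insert x F)
  then obtain d where d: "d \<in> F" "\<forall>e\<in>F. add_dvd d e" by auto
  have "add_dvd_in N x d \<or> add_dvd_in N d x"
    using assms(1) d(1) insert.prems by (auto simp: valuation_submonoid_def)
  then have "add_dvd x d \<or> add_dvd d x"
    by (auto simp: add_dvd_in_def principal_add_ideal_def)
  moreover have "add_dvd x x" by (auto simp: add_dvd_iff intro: exI[of _ 0])
  ultimately show ?case using d add_dvd_trans by blast
qed

lemma atomic_decomposition:
  assumes "atomic_monoid TYPE('m)"
  obtains A where "set_mset A \<subseteq> add_atoms" "\<Sum>\<^sub># A = (m::'m)"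
proof (cases "m = 0")
  case True
  then show ?thesis using that[of "{#}"] by simp
next
  case False
  then show ?thesis using assms that reduced unfolding atomic_monoid_def by blast
qed

text \<open>
  If \<open>m = u + v\<close>, then adding a fixed length of \<open>v\<close> maps the lengths of \<open>u\<close> injectively to lengths
  of \<open>m\<close>.
\<close>
lemma finite_length_set_divisor:
  assumes atomic: "atomic_monoid TYPE('m)" and "finite (length_set m)" "add_dvd u (m::'m)"
  shows "finite (length_set u)"
proof -
  obtain v where v: "m = u + v" using assms(3) by (auto simp: add_dvd_iff)
  obtain B where B: "set_mset B \<subseteq> add_atoms" "\<Sum>\<^sub># B = v"
    using atomic_decomposition[OF atomic] by blast
  have "(\<lambda>l. l + size B) ` length_set u \<subseteq> length_set m"
  proof clarify
    fix l assume "l \<in> length_set u"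
    then obtain A where A: "set_mset A \<subseteq> add_atoms" "\<Sum>\<^sub># A = u" "l = size A"
      by (auto simp: length_set_def)
    then have "set_mset (A + B) \<subseteq> add_atoms" "\<Sum>\<^sub># (A + B) = m" "l + size B = size (A + B)"
      using B v by auto
    then show "l + size B \<in> length_set m" unfolding length_set_def by blast
  qed
  then have "finite ((\<lambda>l. l + size B) ` length_set u)"
    using assms(2) by (rule finite_subset)
  then show ?thesis by (rule finite_imageD) (auto intro: inj_onI)
qed

text \<open>
  Each nonzero summand contributes at least one atom to a decomposition of the sum into atoms.
\<close>
lemma sum_of_nonzero_le_length:
  assumes "atomic_monoid TYPE('m)" "0 \<notin> set us"
  shows "\<exists>l \<in> length_set (sum_list us + (v::'m)). length us \<le> l"
proof -
  have "\<exists>A. set_mset A \<subseteq> add_atoms \<and> \<Sum>\<^sub># A = sum_list us + v \<and> length us \<le> size A"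
    using assms(2)
  proof (induction us)
    case Nil
    then show ?case using atomic_decomposition[OF assms(1), of v] by auto
  next
    case (Cons u us)
    then obtain A where A: "set_mset A \<subseteq> add_atoms" "\<Sum>\<^sub># A = sum_list us + v" "length us \<le> size A"
      by auto
    obtain B where B: "set_mset B \<subseteq> add_atoms" "\<Sum>\<^sub># B = u"
      using atomic_decomposition[OF assms(1)] by blast
    then have "0 < size B" using Cons.prems by (cases B) auto
    with A B show ?case
      by (intro exI[of _ "B + A"]) (auto simp: add.assoc)
  qed
  then show ?thesis unfolding length_set_def by blast
qed


section \<open>Supports of products over a reduced monoid\<close>

lemma lookup_mult_0:
  "Poly_Mapping.lookup (f * g) (0::'m) = Poly_Mapping.lookup f 0 * Poly_Mapping.lookup g 0"
  by (rule lookup_mult_unique) (auto simp: add_eq_0_iff eq_commute[of 0])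

text \<open>
  An exponent \<open>u\<close> of \<open>g\<close> that occurs in a decomposition \<open>m = u + v\<close> divides \<open>m\<close>, so minimality
  leaves only \<open>m = m + 0\<close>.
\<close>
lemma lookup_mult_minimal:
  assumes "\<And>u. u \<in> Poly_Mapping.keys g \<Longrightarrow> add_dvd u m \<Longrightarrow> u = m"
  shows "Poly_Mapping.lookup (g * s) (m::'m) = Poly_Mapping.lookup g m * Poly_Mapping.lookup s 0"
proof (rule lookup_mult_unique)
  fix u v assume "Poly_Mapping.lookup g u \<noteq> 0" and eq: "m = u + v"
  then have "u = m" using assms by (auto simp: in_keys_iff add_dvd_iff)
  with eq have "u + v = u + 0" by simp
  then have "v = 0" by (rule cancel)
  with \<open>u = m\<close> show "u = m \<and> v = 0" ..
qed simp

lemma exponent_of_product: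
  fixes gs :: "('m \<Rightarrow>\<^sub>0 'f::semiring_1) list"
  assumes "Poly_Mapping.lookup (prod_list gs * s) m \<noteq> 0"
    and "\<And>g. g \<in> set gs \<Longrightarrow> Poly_Mapping.lookup g 0 = 0"
  shows "\<exists>us v. length us = length gs \<and> 0 \<notin> set us \<and> m = sum_list us + v"
  using assms
proof (induction gs arbitrary: m)
  case Nil
  then show ?case by (auto intro: exI[of _ "[]"])
next
  case (Cons g gs)
  from Cons.prems(1) have "Poly_Mapping.lookup (g * (prod_list gs * s)) m \<noteq> 0"
    by (simp add: mult.assoc)
  then obtain u w where uw: "Poly_Mapping.lookup g u \<noteq> 0"
    "Poly_Mapping.lookup (prod_list gs * s) w \<noteq> 0" "m = u + w"
    by (rule keys_multE)
  then obtain us v where "length us = length gs" "0 \<notin> set us" "w = sum_list us + v"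
    using Cons.IH[OF uw(2)] Cons.prems(2) by auto
  moreover have "u \<noteq> 0" using uw(1) Cons.prems(2) by auto
  ultimately show ?case
    using uw(3) by (intro exI[of _ "u # us"] exI[of _ v]) (auto simp: add.assoc)
qed

lemma divide_out_monomial:
  fixes f :: "'m \<Rightarrow>\<^sub>0 'f::semiring_1"
  assumes "\<And>m. m \<in> Poly_Mapping.keys f \<Longrightarrow> add_dvd d m"
  obtains g where "f = Poly_Mapping.single d 1 * g"
proof -
  have "\<forall>m\<in>Poly_Mapping.keys f. \<exists>y. m = d + y" using assms by (auto simp: add_dvd_iff)
  then obtain c where c: "\<And>m. m \<in> Poly_Mapping.keys f \<Longrightarrow> m = d + c m" by metis
  let ?g = "\<Sum>m\<in>Poly_Mapping.keys f. Poly_Mapping.single (c m) (Poly_Mapping.lookup f m)"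
  have "Poly_Mapping.single d 1 * ?g =
      (\<Sum>m\<in>Poly_Mapping.keys f. Poly_Mapping.single m (Poly_Mapping.lookup f m))"
    unfolding sum_distrib_left mult_single using c by (intro sum.cong) auto
  also have "\<dots> = f"
    by (rule poly_mapping_eqI)
      (simp add: lookup_sum lookup_single when_def in_keys_iff)
  finally show ?thesis using that by metis
qed

text \<open>
  The monomial is \<open>X\<^sup>d\<close>, where \<open>d\<close> is the least of the greatest divisors of the exponents of \<open>f\<close>.
  For an exponent \<open>k\<close> whose greatest divisor is \<open>d\<close>, the cofactor of \<open>k\<close> is an exponent of \<open>g\<close>,
  and its lengths are finite in number by hypothesis.
\<close>
lemma monomial_times_finite_length:
  fixes f :: "'m \<Rightarrow>\<^sub>0 'f::semiring_1"
  assumes N: "valuation_submonoid N" "greatest_divisor_submonoid N"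
    and finite_lengths: "\<And>m::'m. finite (length_set (gd_cofactor N m))"
    and "f \<noteq> 0"
  obtains d g m where "f = Poly_Mapping.single d 1 * g" "m \<in> Poly_Mapping.keys g"
    "finite (length_set m)"
proof -
  have "gd N ` Poly_Mapping.keys f \<subseteq> N"
    using gd_greatest_divisor[OF N(2)] by (auto simp: is_greatest_divisor_def)
  moreover have "gd N ` Poly_Mapping.keys f \<noteq> {}" using \<open>f \<noteq> 0\<close> by simp
  ultimately obtain k where k: "k \<in> Poly_Mapping.keys f"
    and min: "\<And>m. m \<in> Poly_Mapping.keys f \<Longrightarrow> add_dvd (gd N k) (gd N m)"
    using valuation_submonoid_min[OF N(1), of "gd N ` Poly_Mapping.keys f"] by auto
  have gd_dvd: "add_dvd (gd N m) m" for m
    using gd_greatest_divisor[OF N(2), of m] by (simp add: is_greatest_divisor_def)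
  obtain g where g: "f = Poly_Mapping.single (gd N k) 1 * g"
    using min gd_dvd add_dvd_trans by (metis divide_out_monomial)
  obtain y where y: "k = gd N k + y" using gd_dvd[of k] by (auto simp: add_dvd_iff)
  then have "gd_cofactor N k = y" by (rule gd_cofactor_eqI)
  moreover have "Poly_Mapping.lookup g y = Poly_Mapping.lookup f k"
    using lookup_single_mult[of "gd N k" g y] cancel by (simp flip: g y)
  ultimately show ?thesis
    using that[OF g, of y] k finite_lengths[of k] by (simp add: in_keys_iff)
qed

end

section \<open>Localizing a monoid algebra at the elements with nonzero constant coefficient\<close>

locale monoid_algebra_localization = reduced_cancellative_monoid M
  for M :: "'m::comm_monoid_add itself" +
  fixes S :: "('m \<Rightarrow>\<^sub>0 'f::field) set"
  assumes torsion_free: "n > 0 \<Longrightarrow> (\<Sum>i<n::nat. a) = (\<Sum>i<n. b) \<Longrightarrow> a = (b::'m)"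
    and S_def: "S = {f. Poly_Mapping.lookup f 0 \<noteq> 0}"
begin

sublocale saturated_localization S
proof
  show "f = 0 \<or> g = 0" if "f * g = 0" for f g :: "'m \<Rightarrow>\<^sub>0 'f"
    using that
    by (rule monoid_algebra_no_zero_divisors[rotated -1]) (fact cancel, fact torsion_free)
qed (simp_all add: S_def lookup_mult_0)

sublocale loc: domain "localization S"
  by (rule domain_localization)

abbreviation monom :: "'m \<Rightarrow> 'm \<Rightarrow>\<^sub>0 'f" where
  "monom m \<equiv> Poly_Mapping.single m 1"

abbreviation loc_monom :: "'m \<Rightarrow> (('m \<Rightarrow>\<^sub>0 'f) \<times> ('m \<Rightarrow>\<^sub>0 'f)) set" where
  "loc_monom m \<equiv> loc_frac S (monom m) 1"

lemma monom_in_S_iff: "monom m \<in> S \<longleftrightarrow> m = 0"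
  by (simp add: S_def lookup_single when_def)

lemma loc_monom_add: "loc_monom (a + b) = loc_monom a \<otimes>\<^bsub>L\<^esub> loc_monom b"
  by (simp add: mult_loc one_in mult_single)

text \<open>
  If \<open>X\<^sup>b s = X\<^sup>a f\<close> with \<open>s \<in> S\<close>, then the coefficient of \<open>b\<close> on the left is \<open>s(0) \<noteq> 0\<close>, while all
  exponents on the right lie in \<open>a + M\<close>.
\<close>
lemma loc_monom_divides_iff: "loc_monom a divides\<^bsub>L\<^esub> loc_monom b \<longleftrightarrow> add_dvd a b"
proof
  assume "loc_monom a divides\<^bsub>L\<^esub> loc_monom b"
  then obtain f s where "s \<in> S" "loc_monom b = loc_monom a \<otimes>\<^bsub>L\<^esub> loc_frac S f s"
    by (auto elim!: dividesE carrierE)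
  then have eq: "monom b * s = monom a * f"
    by (simp add: mult_loc one_in loc_frac_eq_iff mult_in_iff)
  have "Poly_Mapping.lookup (monom b * s) (b + 0) = Poly_Mapping.lookup s 0"
    by (rule lookup_single_mult) (rule cancel)
  then have "Poly_Mapping.lookup (monom a * f) b \<noteq> 0"
    using \<open>s \<in> S\<close> eq by (simp add: S_def)
  then obtain v where "b = a + v"
    by (rule keys_multE) (auto simp: lookup_single when_def split: if_splits)
  then show "add_dvd a b" by (auto simp: add_dvd_iff)
next
  assume "add_dvd a b"
  then obtain c where "b = a + c" by (auto simp: add_dvd_iff)
  then show "loc_monom a divides\<^bsub>L\<^esub> loc_monom b"
    by (intro dividesI[of "loc_monom c"]) (simp_all add: loc_monom_add one_in)
qed

lemma not_ring_ACCP: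
  assumes "\<not> monoid_ACCP TYPE('m)"
  shows "\<not> ring_ACCP L"
proof
  assume ACCP: "ring_ACCP L"
  obtain I :: "nat \<Rightarrow> 'm set" where I: "\<forall>n. \<exists>b. I n = principal_add_ideal UNIV b" "incseq I"
    and unstable: "\<nexists>k. \<forall>n\<ge>k. I n = I k"
    using assms unfolding monoid_ACCP_def by blast
  obtain b where b: "\<And>n. I n = principal_add_ideal UNIV (b n)" using I(1) by metis
  define J where "J n = PIdl\<^bsub>L\<^esub> (loc_monom (b n))" for n
  have sub: "J n \<subseteq> J k \<longleftrightarrow> I n \<subseteq> I k" for n k
    unfolding J_def b principal_add_ideal_subset_iff
    using loc.to_contain_is_to_divide loc_monom_divides_iff one_in by simp
  have "\<forall>n. principalideal (J n) L" "incseq J"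
    using I(2) sub one_in
    by (auto simp: J_def incseq_def intro: loc.cgenideal_is_principalideal)
  then obtain k where "\<forall>n\<ge>k. J n = J k" using ACCP unfolding ring_ACCP_def by blast
  then have "\<forall>n\<ge>k. I n = I k" using sub by blast
  with unstable show False by blast
qed

text \<open>
  If \<open>X\<^sup>a\<close> is a product of two fractions with numerators \<open>f\<close> and \<open>g\<close>, then \<open>a\<close> is an exponent of
  \<open>f * g\<close>. An atom \<open>a\<close> has no decomposition into two nonzero exponents, so \<open>f\<close> or \<open>g\<close> has a
  constant term.
\<close>
lemma ring_irreducible_loc_monom:
  assumes a: "a \<in> add_atoms"
  shows "ring_irreducible\<^bsub>L\<^esub> (loc_monom a)"
proof (rule loc.ring_irreducibleI)
  have "a \<noteq> 0" using a reduced by (auto simp: add_atoms_def)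
  then show "loc_monom a \<notin> Units L" by (simp add: loc_frac_Units_iff one_in monom_in_S_iff)
  have "monom a \<noteq> 0" by (metis lookup_single_eq lookup_zero one_neq_zero)
  then show "loc_monom a \<in> carrier L - {\<zero>\<^bsub>L\<^esub>}"
    by (simp add: loc_frac_eq_zero_iff one_in)
  fix x y assume "x \<in> carrier L" "y \<in> carrier L" and eq: "loc_monom a = x \<otimes>\<^bsub>L\<^esub> y"
  then obtain f s g t where fg: "s \<in> S" "t \<in> S" "x = loc_frac S f s" "y = loc_frac S g t"
    by (metis carrierE)
  then have "monom a * (s * t) = f * g"
    using eq by (simp add: mult_loc loc_frac_eq_iff one_in mult_in_iff)
  moreover have "Poly_Mapping.lookup (monom a * (s * t)) (a + 0) = Poly_Mapping.lookup (s * t) 0"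
    by (rule lookup_single_mult) (rule cancel)
  moreover have "s * t \<in> S" using fg by (simp add: mult_in_iff)
  ultimately have "Poly_Mapping.lookup (f * g) a \<noteq> 0" by (simp add: S_def)
  then obtain u v where uv: "Poly_Mapping.lookup f u \<noteq> 0" "Poly_Mapping.lookup g v \<noteq> 0" "a = u + v"
    by (rule keys_multE)
  with a reduced have "u = 0 \<or> v = 0" by (auto simp: add_atoms_def)
  with uv have "f \<in> S \<or> g \<in> S" by (auto simp: S_def)
  with fg show "x \<in> Units L \<or> y \<in> Units L" by (simp add: loc_frac_Units_iff)
qed

lemma irreducible_product_loc_monom:
  assumes "atomic_monoid TYPE('m)"
  shows "loc.irreducible_product (loc_monom m)"
proof -
  obtain A where "set_mset A \<subseteq> add_atoms" "\<Sum>\<^sub># A = m"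
    using atomic_decomposition[OF assms] by blast
  then show ?thesis
  proof (induction A arbitrary: m)
    case empty
    then show ?case using loc.irreducible_product_one by (simp add: one_loc)
  next
    case (add a A)
    then show ?case
      using ring_irreducible_loc_monom one_in
      by (auto simp: loc_monom_add intro!: loc.irreducible_product_Cons)
  qed
qed

text \<open>
  The bound is the largest length of an exponent \<open>m\<^sub>0\<close> that divides \<open>m\<close> and is minimal in the support
  of \<open>g\<close>. Minimality ensures that \<open>m\<^sub>0\<close> remains an exponent after multiplication with the
  denominators in \<open>S\<close>, although \<open>m\<close> may be cancelled by them.
\<close>
lemma factorization_length_bounded:
  assumes atomic: "atomic_monoid TYPE('m)"
    and m: "m \<in> Poly_Mapping.keys g" "finite (length_set m)" and "s \<in> S"
  obtains k where "\<And>fs. set fs \<subseteq> carrier L - Units L \<Longrightarrow>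
    foldr (\<otimes>\<^bsub>L\<^esub>) fs \<one>\<^bsub>L\<^esub> = loc_frac S g s \<Longrightarrow> length fs \<le> k"
proof -
  obtain m\<^sub>0 where m\<^sub>0: "m\<^sub>0 \<in> Poly_Mapping.keys g" "add_dvd m\<^sub>0 m"
    and minimal: "\<And>u. u \<in> Poly_Mapping.keys g \<Longrightarrow> add_dvd u m\<^sub>0 \<Longrightarrow> u = m\<^sub>0"
    using minimal_divisor_in_finite_set[OF finite_keys m(1)] by blast
  have fin: "finite (length_set m\<^sub>0)"
    by (rule finite_length_set_divisor[OF atomic m(2) m\<^sub>0(2)])
  show ?thesis
  proof (rule that[of "Max (length_set m\<^sub>0)"])
    fix fs assume "set fs \<subseteq> carrier L - Units L"
      and prod: "foldr (\<otimes>\<^bsub>L\<^esub>) fs \<one>\<^bsub>L\<^esub> = loc_frac S g s"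
    then obtain gs t where gs: "length gs = length fs" "set gs \<inter> S = {}" "t \<in> S"
      "loc_frac S g s = loc_frac S (prod_list gs) t"
      by (metis nonunit_product_fraction)
    have "g * t = prod_list gs * s"
      using gs(3,4) \<open>s \<in> S\<close> by (simp add: loc_frac_eq_iff)
    moreover have "Poly_Mapping.lookup (g * t) m\<^sub>0 \<noteq> 0"
      using lookup_mult_minimal[of g m\<^sub>0 t, OF minimal] m\<^sub>0(1) gs(3)
      by (simp add: S_def in_keys_iff)
    ultimately have "Poly_Mapping.lookup (prod_list gs * s) m\<^sub>0 \<noteq> 0" by simp
    moreover have "Poly_Mapping.lookup h 0 = 0" if "h \<in> set gs" for h
      using gs(2) that by (auto simp: S_def)
    ultimately obtain us v where us: "length us = length gs" "0 \<notin> set us" "m\<^sub>0 = sum_list us + v"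
      using exponent_of_product by blast
    then obtain l where "l \<in> length_set m\<^sub>0" "length us \<le> l"
      using sum_of_nonzero_le_length[OF atomic us(2), of v] by blast
    with fin us(1) gs(1) show "length fs \<le> Max (length_set m\<^sub>0)"
      using Max_ge le_trans by metis
  qed
qed

text \<open>
  Split the numerator as \<open>X\<^sup>d g\<close>: the monomial is a product of irreducible monomials, and \<open>g/s\<close> is
  either a unit or has factorizations into nonunits of bounded length.
\<close>
lemma atomic_domain_localization:
  assumes atomic: "atomic_monoid TYPE('m)"
    and N: "valuation_submonoid N" "greatest_divisor_submonoid N"
    and finite_lengths: "\<And>m::'m. finite (length_set (gd_cofactor N m))"
  shows "atomic_domain L"
proof -
  have "loc.irreducible_product x"
    if "x \<in> carrier L" and x: "x \<noteq> \<zero>\<^bsub>L\<^esub>" "x \<notin> Units L" for x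
  proof -
    obtain f s where s: "s \<in> S" and x_eq: "x = loc_frac S f s"
      using \<open>x \<in> carrier L\<close> by (rule carrierE)
    with x(1) have "f \<noteq> 0" by (simp add: loc_frac_eq_zero_iff)
    then obtain d g m where f: "f = monom d * g"
      and m: "m \<in> Poly_Mapping.keys g" "finite (length_set m)"
      using monomial_times_finite_length[OF N finite_lengths] by metis
    let ?y = "loc_frac S g s"
    have y: "?y \<in> carrier L" using s by simp
    have x_fact: "x = ?y \<otimes>\<^bsub>L\<^esub> loc_monom d"
      using s by (simp add: x_eq f mult_loc one_in mult.commute)
    note monomial_part = irreducible_product_loc_monom[OF atomic, of d]
    show ?thesis
    proof (cases "?y \<in> Units L")
      case True
      then show ?thesis
        using loc.irreducible_product_unit_mult monomial_part x(2) x_fact by simp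
    next
      case False
      have "?y \<noteq> \<zero>\<^bsub>L\<^esub>" using m(1) s by (auto simp: loc_frac_eq_zero_iff)
      moreover obtain k where "\<And>fs. set fs \<subseteq> carrier L - Units L \<Longrightarrow>
          foldr (\<otimes>\<^bsub>L\<^esub>) fs \<one>\<^bsub>L\<^esub> = ?y \<Longrightarrow> length fs \<le> k"
        using factorization_length_bounded[OF atomic m s] by blast
      ultimately have "loc.irreducible_product ?y"
        by (intro loc.irreducible_product_if_bounded[OF y _ False])
      then show ?thesis
        unfolding x_fact using monomial_part by (rule loc.irreducible_product_mult)
    qed
  qed
  then show ?thesis
    unfolding atomic_domain_def loc.irreducible_product_def
    using loc.domain_axioms by blast
qed

end

theorem corollary3p4:
  fixes N :: "'m::comm_monoid_add set"
    and S :: "('m \<Rightarrow>\<^sub>0 'f::field) set"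
  assumes cancellative: "\<And>a b c :: 'm. a + b = a + c \<Longrightarrow> b = c"
    and reduced: "add_units = {0 :: 'm}"
    and torsion_free:
      "\<And>(a::'m) b (n::nat). n > 0 \<Longrightarrow> (\<Sum>i<n. a) = (\<Sum>i<n. b) \<Longrightarrow> a = b"
    and atomic: "atomic_monoid TYPE('m)"
    and N_valuation: "valuation_submonoid N"
    and N_greatest_divisor: "greatest_divisor_submonoid N"
    and finite_lengths: "\<And>m::'m. finite (length_set (gd_cofactor N m))"
    and not_ACCP: "\<not> monoid_ACCP TYPE('m)"
  defines "S \<equiv> {f. Poly_Mapping.lookup f 0 \<noteq> 0}"
  shows "atomic_domain (localization S) \<and> \<not> ring_ACCP (localization S)"
proof -
  interpret monoid_algebra_localization "TYPE('m)" S
    by unfold_locales (fact cancellative, fact reduced, fact torsion_free, simp add: S_def)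
  show ?thesis
    using atomic_domain_localization[OF atomic N_valuation N_greatest_divisor finite_lengths]
      not_ring_ACCP[OF not_ACCP] by simp
qed

end
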